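(* For any positive integer $k$ there exists a pair of elements $a,b$ in Thompson's group $F$ such that no relation of length less than $k$ is satisfied by $a,b$; that is, $w(a,b)\neq 1$ in $F$ for every non-trivial reduced word $w(x,y)$ of length less than $k$.
   Context: Thompson's group $F$ is the group (under composition) of all piecewise linear orientation-preserving homeomorphisms of the unit interval $[0,1]$ with finitely many breakpoints such that all slopes are powers of $2$ (integer exponents) and all breakpoints lie in $\mathbb{Z}[\frac12]$, the ring of dyadic rational numbers. A relation in two variables is a non-trivial reduced word $w(x,y)$ in the letters $x^{\pm1},y^{\pm1}$, i.e. a non-trivial element of the free group on $x,y$; its length is the number of letters of the reduced word. A pair $a,b$ satisfies the relation $w$ if $w(a,b)=1$, where $w(a,b)$ is obtained by substituting $a$ for $x$ and $b$ for $y$. *)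

theory Defs
  imports "HOL-Analysis.Analysis" "HOL-Algebra.Bij"
begin

definition dyadic_rationals :: "real set" where
  "dyadic_rationals = {of_int m / 2 ^ n | (m :: int) (n :: nat). True}"

text \<open>
  A finite set \<open>P\<close> containing the end points cuts the unit interval into closed pieces, on each
  of which \<open>f\<close> is affine with slope \<open>2 powi k\<close>. The set may contain points at which the slope
  does not change; the breakpoints of \<open>f\<close> are contained in \<open>P\<close>.
\<close>

definition dyadic_piecewise_linear :: "(real \<Rightarrow> real) \<Rightarrow> bool" where
  "dyadic_piecewise_linear f \<longleftrightarrow>
     (\<exists>P. finite P \<and> {0, 1} \<subseteq> P \<and> P \<subseteq> {0..1} \<and> P \<subseteq> dyadic_rationals \<and>
        (\<forall>p\<in>P. \<forall>q\<in>P. p < q \<and> {p<..<q} \<inter> P = {} \<longrightarrow>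
           (\<exists>(k :: int) c. \<forall>x\<in>{p..q}. f x = 2 powi k * x + c)))"

text \<open>
  Elements of \<open>Bij {0..1}\<close> are \<open>undefined\<close> outside the unit interval, so that equality of elements
  is equality of maps on the unit interval.
\<close>

definition Thompson_F :: "(real \<Rightarrow> real) monoid" where
  "Thompson_F = BijGroup {0..1}
     \<lparr>carrier := {f \<in> Bij {0..1}. (\<exists>g. homeomorphism {0..1} {0..1} f g) \<and>
                   strict_mono_on {0..1} f \<and> dyadic_piecewise_linear f}\<rparr>"

datatype var = Var_x | Var_y

text \<open>The letter \<open>(v, True)\<close> stands for the variable \<open>v\<close>, and \<open>(v, False)\<close> for its inverse.\<close>

type_synonym word = "(var \<times> bool) list"

definition reduced :: "word \<Rightarrow> bool" where
  "reduced w \<longleftrightarrow> successively (\<lambda>(u, d) (v, e). \<not> (u = v \<and> d \<noteq> e)) w"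

definition is_relation :: "word \<Rightarrow> bool" where
  "is_relation w \<longleftrightarrow> reduced w \<and> w \<noteq> []"

fun letter_value :: "('g, 'm) monoid_scheme \<Rightarrow> 'g \<Rightarrow> 'g \<Rightarrow> var \<times> bool \<Rightarrow> 'g" where
  "letter_value G a b (Var_x, True) = a"
| "letter_value G a b (Var_x, False) = inv\<^bsub>G\<^esub> a"
| "letter_value G a b (Var_y, True) = b"
| "letter_value G a b (Var_y, False) = inv\<^bsub>G\<^esub> b"

primrec word_value :: "('g, 'm) monoid_scheme \<Rightarrow> 'g \<Rightarrow> 'g \<Rightarrow> word \<Rightarrow> 'g" where
  "word_value G a b [] = \<one>\<^bsub>G\<^esub>"
| "word_value G a b (l # w) = letter_value G a b l \<otimes>\<^bsub>G\<^esub> word_value G a b w"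

definition satisfies_relation :: "('g, 'm) monoid_scheme \<Rightarrow> 'g \<Rightarrow> 'g \<Rightarrow> word \<Rightarrow> bool" where
  "satisfies_relation G a b w \<longleftrightarrow> word_value G a b w = \<one>\<^bsub>G\<^esub>"

end

theory Submission
  imports Defs
begin

text \<open>
  Any two reduced words become parts of one reduced word after inserting a suitable letter between
  them, so it suffices to find, for one reduced word \<open>W\<close> of length \<open>n\<close>, a pair \<open>a, b\<close> and points
  \<open>x\<^sub>0 < \<dots> < x\<^sub>n\<close> such that the \<open>i\<close>-th letter of \<open>W\<close> moves \<open>x\<^bsub>i+1\<^esub>\<close> to \<open>x\<^sub>i\<close>: then every nonempty
  part of \<open>W\<close> moves one of these points. This prescribes finitely many values of \<open>a\<close> and of \<open>b\<close>,
  in an order preserving way, and every order preserving finite partial map between dyadic points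
  extends to an element of Thompson's group: every natural number \<open>m > 0\<close> is a sum of any
  number \<open>n \<ge> m\<close> of powers of two, and these serve as slopes on a fine uniform grid.
\<close>

section \<open>Dyadic rationals, and natural numbers as sums of powers of two\<close>

lemma dyadic_rationals_iff: "x \<in> dyadic_rationals \<longleftrightarrow> (\<exists>(m::int) (n::nat). x = of_int m / 2 ^ n)"
  by (auto simp: dyadic_rationals_def)

lemma dyadic_rationals_of_nat_divide: "real m / 2 ^ n \<in> dyadic_rationals"
  unfolding dyadic_rationals_iff by (metis of_int_of_nat_eq)

lemma dyadic_rationals_of_nat: "real m \<in> dyadic_rationals"
  using dyadic_rationals_of_nat_divide[of m 0] by simp

lemma dyadic_rationals_powi: "2 powi k \<in> dyadic_rationals"
proof (cases "k \<ge> 0")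
  case True
  then have "2 powi k = real_of_int (2 ^ nat k) / 2 ^ 0"
    by (simp add: power_int_def)
  then show ?thesis unfolding dyadic_rationals_iff by blast
next
  case False
  then have "2 powi k = real_of_int 1 / 2 ^ nat (- k)"
    by (simp add: power_int_def field_simps)
  then show ?thesis unfolding dyadic_rationals_iff by blast
qed

lemma dyadic_rationals_add:
  assumes "x \<in> dyadic_rationals" "y \<in> dyadic_rationals"
  shows "x + y \<in> dyadic_rationals"
proof -
  obtain m n m' n' where "x = of_int m / 2 ^ n" "y = of_int m' / 2 ^ n'"
    using assms unfolding dyadic_rationals_iff by blast
  then have "x + y = of_int (m * 2 ^ n' + m' * 2 ^ n) / 2 ^ (n + n')"
    by (simp add: add_frac_eq power_add)
  then show ?thesis unfolding dyadic_rationals_iff by blast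
qed

lemma dyadic_rationals_sum:
  "(\<And>i. i \<in> A \<Longrightarrow> f i \<in> dyadic_rationals) \<Longrightarrow> sum f A \<in> dyadic_rationals"
  using dyadic_rationals_of_nat[of 0]
  by (induction A rule: infinite_finite_induct) (simp_all add: dyadic_rationals_add)

lemma dyadic_rationals_divide_power:
  assumes "x \<in> dyadic_rationals"
  shows "x / 2 ^ k \<in> dyadic_rationals"
proof -
  obtain m n where "x = of_int m / 2 ^ n"
    using assms unfolding dyadic_rationals_iff by blast
  then have "x / 2 ^ k = of_int m / 2 ^ (n + k)"
    by (simp add: field_simps power_add)
  then show ?thesis unfolding dyadic_rationals_iff by blast
qed

text \<open>Halving a summand increases the number of summands by one.\<close>

lemma nat_as_sum_of_powers_of_two:
  assumes "0 < m" "m \<le> n"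
  shows "\<exists>e :: nat \<Rightarrow> int. (\<Sum>j<n. 2 powi e j) = real m"
  using assms(2)
proof (induction n rule: dec_induct)
  case base
  show ?case by (rule exI[of _ "\<lambda>_. 0"]) simp
next
  case (step n)
  then obtain e :: "nat \<Rightarrow> int" where e: "(\<Sum>j<n. 2 powi e j) = real m" by blast
  obtain l where l: "n = Suc l" using assms(1) step(1) by (cases n) auto
  let ?e = "e(l := e l - 1, n := e l - 1)"
  have "(\<Sum>j<l. 2 powi ?e j) = (\<Sum>j<l. 2 powi e j :: real)"
    by (intro sum.cong) (auto simp: l)
  then have "(\<Sum>j<Suc n. 2 powi ?e j) = real m"
    using e by (simp add: l power_int_diff)
  then show ?case by blast
qed

section \<open>Finite increasing partial maps realised by partial sums of powers of two\<close>

text \<open>The equivalence, read for two pairs in both orders, forces \<open>p = p'\<close> exactly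
  when \<open>r = r'\<close>; so \<open>Z\<close> is the graph of an injective, strictly increasing
  partial map.\<close>

definition order_pairing :: "(nat \<times> nat) set \<Rightarrow> bool" where
  "order_pairing Z \<longleftrightarrow>
     (\<forall>p r p' r'. (p, r) \<in> Z \<longrightarrow> (p', r') \<in> Z \<longrightarrow> (p < p' \<longleftrightarrow> r < r'))"

lemma order_pairingD:
  "order_pairing Z \<Longrightarrow> (p, r) \<in> Z \<Longrightarrow> (p', r') \<in> Z \<Longrightarrow> p < p' \<longleftrightarrow> r < r'"
  by (simp add: order_pairing_def)

lemma order_pairing_subset: "order_pairing Z \<Longrightarrow> Y \<subseteq> Z \<Longrightarrow> order_pairing Y"
  by (simp add: order_pairing_def subset_iff)

lemma sum_lessThan_add:
  fixes f :: "nat \<Rightarrow> 'a :: comm_monoid_add"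
  shows "(\<Sum>j<m + n. f j) = (\<Sum>j<m. f j) + (\<Sum>j<n. f (m + j))"
  by (induction n) (simp_all add: add.assoc)

text \<open>Pairs are added by increasing first entry. Between the last pair \<open>(p0, r0)\<close>
  and a new one there are \<open>L * (p - p0)\<close> free summands, at least \<open>L\<close> and
  hence at least \<open>r - r0\<close>, enough to write \<open>r - r0\<close> as a sum of powers of
  two. The pair \<open>(0, 0)\<close> stands for the empty sum.\<close>

lemma order_pairing_partial_sums:
  assumes "finite Z" "order_pairing (insert (0, 0) Z)" "\<And>p r. (p, r) \<in> Z \<Longrightarrow> r \<le> L"
  shows "\<exists>e :: nat \<Rightarrow> int. \<forall>(p, r)\<in>Z. (\<Sum>j < L * p. 2 powi e j) = real r"
  using assms
proof (induction Z rule: finite_ranking_induct[where f = fst])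
  case empty
  then show ?case by simp
next
  case (insert z Z)
  obtain p r where z: "z = (p, r)" by force
  have "order_pairing (insert (0, 0) Z)"
    by (rule order_pairing_subset[OF insert.prems(1)]) auto
  with insert obtain e :: "nat \<Rightarrow> int"
    where e: "\<And>p r. (p, r) \<in> Z \<Longrightarrow> (\<Sum>j < L * p. 2 powi e j) = real r"
    by fast
  have e0: "(\<Sum>j < L * p. 2 powi e j) = real r" if "(p, r) \<in> insert (0, 0) Z" for p r
    using that e by auto
  have "finite (fst ` insert (0, 0) Z)" using insert.hyps by auto
  then have "Max (fst ` insert (0, 0) Z) \<in> fst ` insert (0, 0) Z"
    by (intro Max_in) auto
  then obtain p0 r0 where pr0: "(p0, r0) \<in> insert (0, 0) Z" "Max (fst ` insert (0, 0) Z) = p0"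
    by force
  have max: "p' \<le> p0" if "(p', r') \<in> insert (0, 0) Z" for p' r'
    using that pr0(2) \<open>finite (fst ` insert (0, 0) Z)\<close> by (metis Max_ge fst_conv image_eqI)
  have "p0 \<le> p" using pr0(1) insert.hyps(2) z by fastforce
  have lt: "p0 < p \<longleftrightarrow> r0 < r" "p < p0 \<longleftrightarrow> r < r0"
    using order_pairingD[OF insert.prems(1), of p0 r0 p r]
      order_pairingD[OF insert.prems(1), of p r p0 r0] pr0(1) z by auto
  show ?case
  proof (cases "p0 < p")
    \<comment> \<open>The induction allows ties in the first entry; then the new pair equals an old
      one or \<open>(0, 0)\<close>.\<close>
    case False
    then have "p = p0" "r = r0" using \<open>p0 \<le> p\<close> lt by auto
    then show ?thesis using e0[OF pr0(1)] e z by auto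
  next
    case True
    then have "r0 < r" using lt by simp
    have "r \<le> L" using insert.prems(2)[of p r] z by simp
    have "r - r0 \<le> L * 1" using \<open>r \<le> L\<close> by simp
    also have "\<dots> \<le> L * (p - p0)" using True by (intro mult_le_mono2) simp
    finally obtain e' :: "nat \<Rightarrow> int"
      where e': "(\<Sum>j < L * (p - p0). 2 powi e' j) = real (r - r0)"
      using nat_as_sum_of_powers_of_two[of "r - r0" "L * (p - p0)"] \<open>r0 < r\<close> by auto
    \<comment> \<open>The new exponents are appended behind the old ones. Every earlier pair has
      first entry at most \<open>p0\<close>, so its sum is unchanged.\<close>
    define h where "h j = (if j < L * p0 then e j else e' (j - L * p0))" for j
    have old: "(\<Sum>j < L * q. 2 powi h j) = (\<Sum>j < L * q. 2 powi e j :: real)" if "q \<le> p0" for q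
    proof (intro sum.cong refl)
      fix j assume "j \<in> {..<L * q}"
      then have "j < L * p0" using mult_le_mono2[OF that, of L] by (simp only: lessThan_iff)
      then show "2 powi h j = (2 powi e j :: real)" by (simp add: h_def)
    qed
    have Lp: "L * p = L * p0 + L * (p - p0)"
      using True by (simp flip: distrib_left)
    have "(\<Sum>j < L * p. 2 powi h j) =
        (\<Sum>j < L * p0. 2 powi h j) + (\<Sum>j < L * (p - p0). 2 powi h (L * p0 + j) :: real)"
      unfolding Lp by (rule sum_lessThan_add)
    also have "\<dots> = real r0 + real (r - r0)"
      using old[of p0] e0[OF pr0(1)] e' by (simp add: h_def)
    also have "\<dots> = real r" using \<open>r0 < r\<close> by simp
    finally have new: "(\<Sum>j < L * p. 2 powi h j) = real r" .
    have "(\<Sum>j < L * p'. 2 powi h j) = real r'" if "(p', r') \<in> Z" for p' r'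
      using old[of p'] max[of p' r'] e[OF that] that by simp
    with new show ?thesis using z by (intro exI[of _ h]) auto
  qed
qed

section \<open>Piecewise linear maps on a uniform dyadic grid\<close>

definition clamp01 :: "real \<Rightarrow> real" where
  "clamp01 t = max 0 (min 1 t)"

text \<open>A sum of ramps: the \<open>j\<close>-th summand rises only across the
  \<open>j\<close>-th cell of width \<open>1 / 2 ^ T\<close>. Continuity is thus immediate, and
  values at grid points are scaled partial sums.\<close>

definition grid_map :: "nat \<Rightarrow> nat \<Rightarrow> (nat \<Rightarrow> int) \<Rightarrow> real \<Rightarrow> real" where
  "grid_map T K e x = (\<Sum>j < 2 ^ T. 2 powi e j * clamp01 (2 ^ T * x - real j)) / 2 ^ K"

lemma clamp01_mono: "s \<le> t \<Longrightarrow> clamp01 s \<le> clamp01 t"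
  by (auto simp: clamp01_def)

lemma grid_point_in_unit_interval: "i \<le> 2 ^ T \<Longrightarrow> real i / 2 ^ T \<in> {0..1}"
  using of_nat_le_iff[of i "2 ^ T", where 'a = real] by (simp add: divide_le_eq_1)

lemma continuous_on_grid_map: "continuous_on A (grid_map T K e)"
  unfolding grid_map_def clamp01_def by (intro continuous_intros) auto

text \<open>On the \<open>i\<close>-th cell the ramps before \<open>i\<close> have reached 1, those
  after \<open>i\<close> are still 0, and only the \<open>i\<close>-th one varies.\<close>

lemma grid_map_on_piece:
  assumes "i < 2 ^ T" "x \<in> {real i / 2 ^ T .. real (Suc i) / 2 ^ T}"
  shows "grid_map T K e x = ((\<Sum>j<i. 2 powi e j) + 2 powi e i * (2 ^ T * x - real i)) / 2 ^ K"
proof -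
  have x: "real i \<le> 2 ^ T * x" "2 ^ T * x \<le> real (Suc i)"
    using assms(2) by (auto simp: field_simps)
  have "clamp01 (2 ^ T * x - real j) = 1" if "j < i" for j
    using x that by (auto simp: clamp01_def)
  moreover have "clamp01 (2 ^ T * x - real i) = 2 ^ T * x - real i"
    using x by (auto simp: clamp01_def)
  moreover have "clamp01 (2 ^ T * x - real j) = 0" if "i < j" for j
    using x that by (auto simp: clamp01_def)
  moreover have "{..<2 ^ T} = insert i ({..<i} \<union> {i<..<2 ^ T :: nat})"
    using assms(1) by auto
  then have "(\<Sum>j < 2 ^ T. 2 powi e j * clamp01 (2 ^ T * x - real j)) =
      (\<Sum>j<i. 2 powi e j * clamp01 (2 ^ T * x - real j)) +
      2 powi e i * clamp01 (2 ^ T * x - real i) +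
      (\<Sum>j\<in>{i<..<2 ^ T}. 2 powi e j * clamp01 (2 ^ T * x - real j))"
    by (simp add: sum.union_disjoint Int_def)
  ultimately show ?thesis
    by (simp add: grid_map_def)
qed

lemma grid_map_at_grid_point:
  assumes "i \<le> 2 ^ T"
  shows "grid_map T K e (real i / 2 ^ T) = (\<Sum>j<i. 2 powi e j) / 2 ^ K"
proof -
  have "(\<Sum>j < 2 ^ T. 2 powi e j * clamp01 (real i - real j)) =
      (\<Sum>j<i. 2 powi e j * clamp01 (real i - real j))"
    using assms by (intro sum.mono_neutral_right) (auto simp: clamp01_def)
  also have "\<dots> = (\<Sum>j<i. 2 powi e j)"
    by (intro sum.cong) (auto simp: clamp01_def)
  finally show ?thesis by (simp add: grid_map_def)
qed

text \<open>No ramp decreases, and the ramp of the half-open cell containing \<open>x\<close> has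
  not yet reached 1 at \<open>x\<close>, so it strictly increases from \<open>x\<close> to
  \<open>y\<close>.\<close>

lemma strict_mono_on_grid_map: "strict_mono_on {0..1} (grid_map T K e)"
proof (rule strict_mono_onI)
  fix x y :: real
  assume xy: "x \<in> {0..1}" "y \<in> {0..1}" "x < y"
  define i where "i = nat \<lfloor>2 ^ T * x\<rfloor>"
  have "0 \<le> 2 ^ T * x" "2 ^ T * x < 2 ^ T * 1"
    using xy by (auto intro!: mult_strict_left_mono)
  then have i: "real i \<le> 2 ^ T * x" "2 ^ T * x < real i + 1" unfolding i_def by linarith+
  then have "real i < real (2 ^ T)" using \<open>2 ^ T * x < 2 ^ T * 1\<close>
    by (simp only: of_nat_power of_nat_numeral mult_1_right)
  then have "i < 2 ^ T" using of_nat_less_iff by blast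
  have lt: "2 ^ T * x < 2 ^ T * y" using xy by simp
  have "(\<Sum>j < 2 ^ T. 2 powi e j * clamp01 (2 ^ T * x - real j)) <
      (\<Sum>j < 2 ^ T. 2 powi e j * clamp01 (2 ^ T * y - real j))"
  proof (rule sum_strict_mono_ex1)
    show "\<forall>j\<in>{..<2 ^ T}. 2 powi e j * clamp01 (2 ^ T * x - real j)
        \<le> 2 powi e j * clamp01 (2 ^ T * y - real j)"
      using lt by (intro ballI mult_left_mono clamp01_mono) auto
    have "clamp01 (2 ^ T * x - real i) < clamp01 (2 ^ T * y - real i)"
      using lt i unfolding clamp01_def by linarith
    then show "\<exists>j\<in>{..<2 ^ T}. 2 powi e j * clamp01 (2 ^ T * x - real j)
        < 2 powi e j * clamp01 (2 ^ T * y - real j)"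
      using \<open>i < 2 ^ T\<close> by (intro bexI[of _ i] mult_strict_left_mono) auto
  qed simp
  then show "grid_map T K e x < grid_map T K e y"
    by (simp add: grid_map_def divide_strict_right_mono)
qed

lemma dyadic_rationals_grid_map:
  assumes "i \<le> 2 ^ T"
  shows "grid_map T K e (real i / 2 ^ T) \<in> dyadic_rationals"
  unfolding grid_map_at_grid_point[OF assms]
  by (intro dyadic_rationals_divide_power dyadic_rationals_sum dyadic_rationals_powi)

section \<open>Meshes of a map and of its inverse\<close>

text \<open>The existential witness of \<open>dyadic_piecewise_linear\<close> is made explicit here,
  so that a mesh can be carried over from a map to its inverse.\<close>

definition is_mesh :: "real set \<Rightarrow> (real \<Rightarrow> real) \<Rightarrow> bool" where
  "is_mesh P f \<longleftrightarrow> finite P \<and> {0, 1} \<subseteq> P \<and> P \<subseteq> {0..1} \<and> P \<subseteq> dyadic_rationals \<and>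
        (\<forall>p\<in>P. \<forall>q\<in>P. p < q \<and> {p<..<q} \<inter> P = {} \<longrightarrow>
           (\<exists>(k :: int) c. \<forall>x\<in>{p..q}. f x = 2 powi k * x + c))"

lemma dyadic_piecewise_linear_iff: "dyadic_piecewise_linear f \<longleftrightarrow> (\<exists>P. is_mesh P f)"
  by (simp add: dyadic_piecewise_linear_def is_mesh_def)

lemma is_mesh_grid_map:
  "is_mesh ((\<lambda>i. real i / 2 ^ T) ` {..2 ^ T}) (grid_map T K e)"
proof -
  let ?P = "(\<lambda>i. real i / 2 ^ T) ` {..2 ^ T}"
  have "\<exists>k c. \<forall>x\<in>{p..q}. grid_map T K e x = 2 powi k * x + c"
    if pq: "p \<in> ?P" "q \<in> ?P" "p < q" "{p<..<q} \<inter> ?P = {}" for p q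
  proof -
    obtain i i' where i: "i' \<le> 2 ^ T" "p = real i / 2 ^ T" "q = real i' / 2 ^ T"
      using pq by auto
    have "i < i'" using \<open>p < q\<close> i by (simp add: divide_less_cancel)
    have "i' = Suc i"
    proof (rule ccontr)
      assume "i' \<noteq> Suc i"
      then have "Suc i < i'" using \<open>i < i'\<close> by simp
      then have "real (Suc i) / 2 ^ T \<in> {p<..<q} \<inter> ?P"
        using i by (auto simp: divide_strict_right_mono intro!: image_eqI[of _ _ "Suc i"])
      then show False using pq(4) by blast
    qed
    \<comment> \<open>The exponent collects the ramp height \<open>2 powi e i\<close>, the
      stretching by \<open>2 ^ T\<close> and the division by \<open>2 ^ K\<close>.\<close>
    then have "grid_map T K e x =
        2 powi (e i + int T - int K) * x + ((\<Sum>j<i. 2 powi e j) - 2 powi e i * real i) / 2 ^ K"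
      if "x \<in> {p..q}" for x
      using grid_map_on_piece[of i T x K e] that i
      by (simp add: power_int_diff power_int_add field_simps)
    then show ?thesis by blast
  qed
  moreover have "{0, 1} \<subseteq> ?P"
    by (auto intro: image_eqI[of _ _ 0] image_eqI[of _ _ "2 ^ T"])
  moreover have "?P \<subseteq> {0..1}"
    using grid_point_in_unit_interval by blast
  ultimately show ?thesis
    unfolding is_mesh_def using dyadic_rationals_of_nat_divide by auto
qed

lemma is_mesh_cong:
  assumes P: "is_mesh P f" and eq: "\<And>x. x \<in> {0..1} \<Longrightarrow> f x = g x"
  shows "is_mesh P g"
proof -
  have "\<exists>k c. \<forall>x\<in>{p..q}. g x = 2 powi k * x + c"
    if pq: "p \<in> P" "q \<in> P" "p < q \<and> {p<..<q} \<inter> P = {}" for p q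
  proof -
    obtain k c where "\<And>x. x \<in> {p..q} \<Longrightarrow> f x = 2 powi k * x + c"
      using P pq unfolding is_mesh_def by meson
    moreover have "p \<in> {0..1}" "q \<in> {0..1}" using P pq(1,2) unfolding is_mesh_def by blast+
    then have "x \<in> {0..1}" if "x \<in> {p..q}" for x using that by simp
    ultimately have "\<forall>x\<in>{p..q}. g x = 2 powi k * x + c" using eq by metis
    then show ?thesis by blast
  qed
  then show ?thesis using P unfolding is_mesh_def by simp
qed

text \<open>Since \<open>f\<close> preserves and reflects order, neighbouring image points come from
  neighbouring mesh points, and inverting an affine piece of slope \<open>2 powi k\<close> gives one
  of slope \<open>2 powi (- k)\<close>.\<close>

lemma is_mesh_inverse:
  assumes P: "is_mesh P f" and f: "strict_mono_on {0..1} f" "f ` P \<subseteq> dyadic_rationals"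
    and hom: "homeomorphism {0..1} {0..1} f g" and ends: "f 0 = 0" "f 1 = 1"
  shows "is_mesh (f ` P) g"
proof -
  have P01: "P \<subseteq> {0..1}" using P by (simp add: is_mesh_def)
  have "\<exists>k c. \<forall>y\<in>{f p..f q}. g y = 2 powi k * y + c"
    if pq: "p \<in> P" "q \<in> P" "f p < f q" "{f p<..<f q} \<inter> f ` P = {}" for p q
  proof -
    have less: "f x < f y \<longleftrightarrow> x < y" if "x \<in> {0..1}" "y \<in> {0..1}" for x y
      using f(1) that by (meson strict_mono_on_less)
    have "p < q" "{p<..<q} \<inter> P = {}"
      using pq less P01 by (auto simp: subset_iff disjoint_iff)
    then obtain k c where kc: "\<And>x. x \<in> {p..q} \<Longrightarrow> f x = 2 powi k * x + c"
      using P pq unfolding is_mesh_def by meson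
    have "g y = 2 powi (- k) * y + - (2 powi (- k) * c)" if y: "y \<in> {f p..f q}" for y
    proof -
      have "y \<in> {0..1}"
      proof -
        have "f p \<in> {0..1}" "f q \<in> {0..1}"
          using pq P01 hom unfolding homeomorphism_def by blast+
        then show ?thesis using y by simp
      qed
      then have gy: "g y \<in> {0..1}" "f (g y) = y"
        using hom by (auto simp: homeomorphism_def)
      then have "g y \<in> {p..q}"
        using y less[of "g y" p] less[of q "g y"] pq P01 by (auto simp: not_less subset_iff)
      then have "y = 2 powi k * g y + c" using kc gy(2) by metis
      then have "2 powi (- k) * y = g y + 2 powi (- k) * c"
        by (simp add: power_int_minus field_simps)
      then show ?thesis by simp
    qed
    then show ?thesis by blast
  qed
  moreover have "f ` P \<subseteq> {0..1}" using hom P01 by (auto simp: homeomorphism_def)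
  moreover have "{0, 1} \<subseteq> f ` P"
    using P ends unfolding is_mesh_def by (metis image_eqI insert_subset empty_subsetI)
  ultimately show ?thesis
    using P f(2) unfolding is_mesh_def by auto
qed

section \<open>Elements of Thompson's group with prescribed values\<close>

lemma in_Thompson_F_carrierI:
  assumes "homeomorphism {0..1} {0..1} f g" "strict_mono_on {0..1} f" "is_mesh P f"
  shows "restrict f {0..1} \<in> carrier Thompson_F"
proof -
  have "bij_betw f {0..1} {0..1}"
    using assms(1,2) by (simp add: bij_betw_def homeomorphism_def strict_mono_on_imp_inj_on)
  then have "restrict f {0..1} \<in> Bij {0..1}"
    by (simp add: Bij_def)
  moreover have "homeomorphism {0..1} {0..1} (restrict f {0..1}) g"
    by (rule homeomorphism_cong[OF assms(1)]) auto
  moreover have "strict_mono_on {0..1} (restrict f {0..1})"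
    using assms(2) by (simp add: strict_mono_on_def)
  moreover have "dyadic_piecewise_linear (restrict f {0..1})"
    unfolding dyadic_piecewise_linear_iff
    using is_mesh_cong[OF assms(3), of "restrict f {0..1}"] by auto
  ultimately show ?thesis
    by (auto simp: Thompson_F_def)
qed

lemma Thompson_F_simps:
  "carrier Thompson_F \<subseteq> Bij {0..1}"
  "\<one>\<^bsub>Thompson_F\<^esub> = (\<lambda>x\<in>{0..1}. x)"
  "f \<in> Bij {0..1} \<Longrightarrow> g \<in> Bij {0..1} \<Longrightarrow> f \<otimes>\<^bsub>Thompson_F\<^esub> g = compose {0..1} f g"
  by (simp_all add: Thompson_F_def BijGroup_def subset_iff)

text \<open>The argument works directly with the definite description behind \<open>inv\<close>.
  Uniqueness is the computation \<open>h x = h (f (g x)) = g x\<close>, together with extensionality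
  outside the interval.\<close>

lemma Thompson_F_inv_equality:
  assumes "f \<in> carrier Thompson_F" "g \<in> carrier Thompson_F"
    and "\<And>x. x \<in> {0..1} \<Longrightarrow> f (g x) = x" "\<And>x. x \<in> {0..1} \<Longrightarrow> g (f x) = x"
  shows "inv\<^bsub>Thompson_F\<^esub> f = g"
  unfolding m_inv_def
proof (rule the_equality)
  have B: "f \<in> Bij {0..1}" "g \<in> Bij {0..1}" using assms(1,2) Thompson_F_simps(1) by blast+
  then show "g \<in> carrier Thompson_F \<and> f \<otimes>\<^bsub>Thompson_F\<^esub> g = \<one>\<^bsub>Thompson_F\<^esub> \<and>
      g \<otimes>\<^bsub>Thompson_F\<^esub> f = \<one>\<^bsub>Thompson_F\<^esub>"
    using assms by (auto simp: Thompson_F_simps compose_def)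
  fix h
  assume h: "h \<in> carrier Thompson_F \<and> f \<otimes>\<^bsub>Thompson_F\<^esub> h = \<one>\<^bsub>Thompson_F\<^esub> \<and>
      h \<otimes>\<^bsub>Thompson_F\<^esub> f = \<one>\<^bsub>Thompson_F\<^esub>"
  then have hB: "h \<in> Bij {0..1}" using Thompson_F_simps(1) by blast
  with h B have "compose {0..1} h f = (\<lambda>x\<in>{0..1}. x)" by (simp add: Thompson_F_simps)
  then have hf: "h (f x) = x" if "x \<in> {0..1}" for x
    using that by (metis compose_eq restrict_apply')
  have "h x = g x" if "x \<in> {0..1}" for x
  proof -
    have "g x \<in> {0..1}" using that B(2) bij_betw_apply unfolding Bij_def by fast
    from hf[OF this] show ?thesis using assms(3)[OF that] by simp
  qed
  then show "h = g"
    using hB B(2) by (intro extensionalityI[of _ "{0..1}"]) (auto simp: Bij_def)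
qed

lemma Thompson_F_extends_order_pairing:
  assumes Z: "finite Z" "order_pairing Z" "Z \<subseteq> {0<..<2 ^ K} \<times> {0<..<2 ^ K}"
  shows "\<exists>a\<in>carrier Thompson_F. inv\<^bsub>Thompson_F\<^esub> a \<in> carrier Thompson_F \<and>
    (\<forall>(p, r)\<in>Z. a (real p / 2 ^ K) = real r / 2 ^ K \<and>
       (inv\<^bsub>Thompson_F\<^esub> a) (real r / 2 ^ K) = real p / 2 ^ K)"
proof -
  \<comment> \<open>The extra pair makes the resulting map fix 1. As \<open>Z\<close> lies strictly
    inside the square, adding both corners keeps the pairing increasing.\<close>
  let ?Z = "insert (2 ^ K, 2 ^ K) Z"
  have "order_pairing (insert (0, 0) ?Z)"
    using Z(2,3) unfolding order_pairing_def by fastforce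
  moreover have "r \<le> 2 ^ K" if "(p, r) \<in> ?Z" for p r
    using that Z(3) by auto
  ultimately obtain e :: "nat \<Rightarrow> int"
    where e: "\<And>p r. (p, r) \<in> ?Z \<Longrightarrow> (\<Sum>j < 2 ^ K * p. 2 powi e j) = real r"
    using order_pairing_partial_sums[of ?Z "2 ^ K"] Z(1) by fast
  \<comment> \<open>Each interval of length \<open>1 / 2 ^ K\<close> splits into
    \<open>2 ^ K\<close> cells, matching \<open>L = 2 ^ K\<close>, which bounds all second entries.
    The point \<open>p / 2 ^ K\<close> has index \<open>2 ^ K * p\<close> in the fine grid.\<close>
  define f where "f = grid_map (K + K) K e"
  have val: "f (real p / 2 ^ K) = real r / 2 ^ K" if "(p, r) \<in> ?Z" for p r
  proof -
    have "p \<le> 2 ^ K" using that Z(3) by auto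
    then have "2 ^ K * p \<le> 2 ^ (K + K)" by (simp add: power_add)
    from grid_map_at_grid_point[OF this, of K e] show ?thesis
      using e[OF that] by (simp add: f_def power_add)
  qed
  have ends: "f 0 = 0" "f 1 = 1"
    using grid_map_at_grid_point[of 0 "K + K" K e] val[of "2 ^ K" "2 ^ K"] by (auto simp: f_def)
  have mono: "strict_mono_on {0..1} f" and cont: "continuous_on {0..1} f"
    unfolding f_def by (rule strict_mono_on_grid_map continuous_on_grid_map)+
  have "f ` {0..1} = {0..1}"
  proof
    show "f ` {0..1} \<subseteq> {0..1}"
      using strict_mono_on_leD[OF mono, of 0] strict_mono_on_leD[OF mono, of _ 1] ends by auto
    show "{0..1} \<subseteq> f ` {0..1}"
    proof
      fix y :: real
      assume "y \<in> {0..1}"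
      then obtain x where "0 \<le> x" "x \<le> 1" "f x = y"
        using IVT'[of f 0 y 1] cont ends by auto
      then show "y \<in> f ` {0..1}" by auto
    qed
  qed
  then obtain g where hom: "homeomorphism {0..1} {0..1} f g"
    using homeomorphism_compact[of "{0..1}" f "{0..1}"] cont mono
    by (auto simp: strict_mono_on_imp_inj_on)
  then have hom': "homeomorphism {0..1} {0..1} g f" by (simp add: homeomorphism_symD)
  have fg: "f (g x) = x" "g (f x) = x" "f x \<in> {0..1}" "g x \<in> {0..1}" if "x \<in> {0..1}" for x
    using hom that by (auto simp: homeomorphism_def)
  let ?P = "(\<lambda>i. real i / 2 ^ (K + K)) ` {..2 ^ (K + K)}"
  have P: "is_mesh ?P f" unfolding f_def by (rule is_mesh_grid_map)
  have dy: "f ` ?P \<subseteq> dyadic_rationals"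
    unfolding f_def using dyadic_rationals_grid_map by blast
  have mono': "strict_mono_on {0..1} g"
    using fg strict_mono_on_less[OF mono] by (intro strict_mono_onI) metis
  let ?f = "restrict f {0..1}" and ?g = "restrict g {0..1}"
  have a: "?f \<in> carrier Thompson_F"
    by (rule in_Thompson_F_carrierI[OF hom mono P])
  have b: "?g \<in> carrier Thompson_F"
    by (rule in_Thompson_F_carrierI[OF hom' mono' is_mesh_inverse[OF P mono dy hom ends]])
  have inv: "inv\<^bsub>Thompson_F\<^esub> ?f = ?g"
    by (rule Thompson_F_inv_equality[OF a b]) (simp_all add: fg del: atLeastAtMost_iff)
  have "?f (real p / 2 ^ K) = real r / 2 ^ K \<and> ?g (real r / 2 ^ K) = real p / 2 ^ K"
    if "(p, r) \<in> Z" for p r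
  proof -
    have "p \<le> 2 ^ K" "r \<le> 2 ^ K" using that Z(3) by auto
    then have "real p / 2 ^ K \<in> {0..1}" "real r / 2 ^ K \<in> {0..1}"
      by (auto dest: grid_point_in_unit_interval simp del: atLeastAtMost_iff)
    with fg(2)[of "real p / 2 ^ K"] val[of p r] that show ?thesis
      by simp
  qed
  then show ?thesis by (intro bexI[OF _ a]) (use b in \<open>unfold inv, fast\<close>)
qed

section \<open>Reduced words and the points moved by their letters\<close>

text \<open>The points are numbered from 1, and the letter \<open>W ! i\<close> moves the point \<open>i + 2\<close> to \<open>i + 1\<close>.
  As all letters
  move points in the same direction, only two adjacent mutually inverse letters could violate
  monotonicity of the prescribed values.\<close>

definition prescribed :: "word \<Rightarrow> var \<Rightarrow> (nat \<times> nat) set" where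
  "prescribed W v =
     {(i + 2, i + 1) | i. i < length W \<and> W ! i = (v, True)} \<union>
     {(i + 1, i + 2) | i. i < length W \<and> W ! i = (v, False)}"

lemma reduced_nth:
  assumes "reduced W" "Suc i < length W" "W ! i = (v, d)" "W ! Suc i = (v, e)"
  shows "d = e"
proof -
  from assms(1)[unfolded reduced_def successively_conv_nth, rule_format, OF assms(2)]
  show ?thesis using assms(3,4) by simp
qed

lemma order_pairing_prescribed:
  assumes "reduced W"
  shows "order_pairing (prescribed W v)"
proof -
  have adj: "i + 1 \<noteq> j" if "i < length W" "j < length W" "W ! i = (v, d)" "W ! j = (v, \<not> d)" for i j d
    using reduced_nth[OF assms, of i v d "\<not> d"] that by auto
  \<comment> \<open>The pairs \<open>(i + 2, i + 1)\<close> and \<open>(j + 1, j + 2)\<close>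
    compare alike in both entries exactly when \<open>i\<close> and \<open>j\<close> differ by at
    least two.\<close>
  have ne: "i + 1 < j \<or> j + 1 < i"
    if "i < length W" "j < length W" "W ! i = (v, True)" "W ! j = (v, False)" for i j
  proof -
    have "i \<noteq> j" using that by auto
    then show ?thesis using adj[of i j True] adj[of j i False] that by fastforce
  qed
  show ?thesis
    unfolding order_pairing_def prescribed_def
    by (auto dest: ne)
qed

lemma finite_prescribed: "finite (prescribed W v)"
  unfolding prescribed_def by simp

text \<open>Only the inverses of the last letter of \<open>u\<close> and of the first letter of
  \<open>v\<close> are forbidden, so at least two of the four letters remain.\<close>

lemma reduced_joined_by_letter:
  assumes "reduced u" "reduced v"
  shows "\<exists>s. reduced (u @ s # v)"
proof -
  obtain x d where x: "u \<noteq> [] \<Longrightarrow> last u = (x, d)" by (cases "last u") auto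
  obtain y e where y: "v \<noteq> [] \<Longrightarrow> hd v = (y, e)" by (cases "hd v") auto
  have "\<exists>z h. \<not> (x = z \<and> d \<noteq> h) \<and> \<not> (z = y \<and> h \<noteq> e)"
    by (metis (full_types) var.exhaust var.distinct(1))
  then obtain z h where "\<not> (x = z \<and> d \<noteq> h)" "\<not> (z = y \<and> h \<noteq> e)" by blast
  then have "reduced (u @ (z, h) # v)"
    using assms x y unfolding reduced_def by (auto simp: successively_append_iff successively_Cons)
  then show ?thesis by blast
qed

lemma reduced_universal_word:
  assumes "finite S" "\<And>w. w \<in> S \<Longrightarrow> reduced w"
  shows "\<exists>W. reduced W \<and> (\<forall>w\<in>S. \<exists>u s. W = u @ w @ s)"
  using assms
proof (induction S)
  case empty
  show ?case by (auto simp: reduced_def intro: exI[of _ "[]"])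
next
  case (insert w S)
  then obtain W where W: "reduced W" "\<And>v. v \<in> S \<Longrightarrow> \<exists>u s. W = u @ v @ s" by blast
  obtain s where s: "reduced (W @ s # w)"
    using reduced_joined_by_letter W(1) insert.prems by blast
  have "\<exists>u t. W @ s # w = u @ v @ t" if "v \<in> insert w S" for v
  proof (cases "v = w")
    case True
    then show ?thesis by (metis append.right_neutral append_Cons append_Nil append_assoc)
  next
    case False
    then show ?thesis using W(2) that by fastforce
  qed
  with s show ?case by blast
qed

text \<open>Products are compositions, so the rightmost letter acts first and each letter lowers the
  index of the point by one. Membership in \<open>Bij\<close> comes along because products are known
  to be compositions only there.\<close>

lemma word_value_moves_points:
  assumes B: "a \<in> Bij {0..1}" "b \<in> Bij {0..1}"
      "inv\<^bsub>Thompson_F\<^esub> a \<in> Bij {0..1}" "inv\<^bsub>Thompson_F\<^esub> b \<in> Bij {0..1}"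
    and pt: "\<And>i. i \<le> length W \<Longrightarrow> pt i \<in> {0..1}"
    and letter: "\<And>i. i < length W \<Longrightarrow> letter_value Thompson_F a b (W ! i) (pt (Suc i)) = pt i"
  shows "word_value Thompson_F a b w \<in> Bij {0..1}"
    and "W = u @ w @ s \<Longrightarrow> word_value Thompson_F a b w (pt (length u + length w)) = pt (length u)"
proof -
  have L: "letter_value Thompson_F a b l \<in> Bij {0..1}" for l
    using B by (cases "(Thompson_F, a, b, l)" rule: letter_value.cases) auto
  show V: "word_value Thompson_F a b w \<in> Bij {0..1}" for w
  proof (induction w)
    case Nil
    then show ?case unfolding word_value.simps Thompson_F_simps(2) by (rule id_Bij)
  next
    case (Cons l w)
    then show ?case by (simp add: Thompson_F_simps(3) L compose_Bij)
  qed
  show "W = u @ w @ s \<Longrightarrow> word_value Thompson_F a b w (pt (length u + length w)) = pt (length u)"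
  \<comment> \<open>The prefix must vary: the leading letter \<open>l\<close> passes from the word
    to the end of \<open>u\<close>.\<close>
  proof (induction w arbitrary: u)
    case Nil
    then show ?case using pt[of "length u"] by (simp add: Thompson_F_simps)
  next
    case (Cons l w)
    have "word_value Thompson_F a b w (pt (length (u @ [l]) + length w)) = pt (length (u @ [l]))"
      using Cons.IH[of "u @ [l]"] Cons.prems by simp
    moreover have "pt (length u + length (l # w)) \<in> {0..1}"
      using pt Cons.prems by simp
    moreover have "letter_value Thompson_F a b l (pt (Suc (length u))) = pt (length u)"
      using letter[of "length u"] Cons.prems by simp
    ultimately show ?case
      by (simp add: Thompson_F_simps L V compose_eq)
  qed
qed

theorem corollary3:
  fixes k :: nat
  assumes "k > 0"
  shows "\<exists>a\<in>carrier Thompson_F. \<exists>b\<in>carrier Thompson_F.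
           \<forall>w. is_relation w \<and> length w < k \<longrightarrow> \<not> satisfies_relation Thompson_F a b w"
proof -
  \<comment> \<open>The alphabet is finite, so only finitely many words are shorter than
    \<open>k\<close> and a single \<open>W\<close> contains all the reduced ones.\<close>
  have "(UNIV :: var set) = {Var_x, Var_y}" using var.exhaust by blast
  then have "finite (UNIV :: var set)" by (metis finite.simps)
  then have "finite (UNIV :: (var \<times> bool) set)" by (simp add: finite_Prod_UNIV)
  then have "finite {w :: word. length w \<le> k}"
    using finite_lists_length_le[of "UNIV :: (var \<times> bool) set" k] by simp
  then have "finite {w. reduced w \<and> length w < k}"
    by (rule rev_finite_subset) auto
  then obtain W where W: "reduced W"
      "\<And>w. reduced w \<Longrightarrow> length w < k \<Longrightarrow> \<exists>u s. W = u @ w @ s"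
    using reduced_universal_word[of "{w. reduced w \<and> length w < k}"] by blast
  \<comment> \<open>The numerators run from 1 to \<open>length W + 1\<close>, so this
    \<open>K\<close> places all points strictly between 0 and 1.\<close>
  define K where "K = length W + 2"
  have "length W + 2 < 2 ^ K" unfolding K_def by (rule less_exp)
  then have sub: "prescribed W v \<subseteq> {0<..<2 ^ K} \<times> {0<..<2 ^ K}" for v
    unfolding prescribed_def by auto
  define pt where "pt i = real (i + 1) / 2 ^ K" for i
  have ex: "\<exists>a\<in>carrier Thompson_F. inv\<^bsub>Thompson_F\<^esub> a \<in> carrier Thompson_F \<and>
      (\<forall>i<length W. (W ! i = (v, True) \<longrightarrow> a (pt (Suc i)) = pt i) \<and>
        (W ! i = (v, False) \<longrightarrow> (inv\<^bsub>Thompson_F\<^esub> a) (pt (Suc i)) = pt i))" for v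
  proof -
    obtain a where a: "a \<in> carrier Thompson_F" "inv\<^bsub>Thompson_F\<^esub> a \<in> carrier Thompson_F"
      and *: "\<And>p r. (p, r) \<in> prescribed W v \<Longrightarrow> a (real p / 2 ^ K) = real r / 2 ^ K \<and>
         (inv\<^bsub>Thompson_F\<^esub> a) (real r / 2 ^ K) = real p / 2 ^ K"
      using Thompson_F_extends_order_pairing[OF finite_prescribed order_pairing_prescribed[OF W(1)] sub]
      by fast
    have "a (pt (Suc i)) = pt i" if "i < length W" "W ! i = (v, True)" for i
      using *[of "i + 2" "i + 1"] that by (simp add: prescribed_def pt_def)
    \<comment> \<open>A negative letter prescribes that \<open>a\<close> moves \<open>pt i\<close>
      up to \<open>pt (Suc i)\<close>, so its inverse moves the point down.\<close>
    moreover have "(inv\<^bsub>Thompson_F\<^esub> a) (pt (Suc i)) = pt i" if "i < length W" "W ! i = (v, False)" for i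
      using *[of "i + 1" "i + 2"] that by (simp add: prescribed_def pt_def)
    ultimately show ?thesis using a by blast
  qed
  obtain a where a: "a \<in> carrier Thompson_F" "inv\<^bsub>Thompson_F\<^esub> a \<in> carrier Thompson_F"
    and a_moves: "\<And>i. i < length W \<Longrightarrow> W ! i = (Var_x, True) \<Longrightarrow> a (pt (Suc i)) = pt i"
      "\<And>i. i < length W \<Longrightarrow> W ! i = (Var_x, False) \<Longrightarrow> (inv\<^bsub>Thompson_F\<^esub> a) (pt (Suc i)) = pt i"
    using ex[of Var_x] by blast
  obtain b where b: "b \<in> carrier Thompson_F" "inv\<^bsub>Thompson_F\<^esub> b \<in> carrier Thompson_F"
    and b_moves: "\<And>i. i < length W \<Longrightarrow> W ! i = (Var_y, True) \<Longrightarrow> b (pt (Suc i)) = pt i"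
      "\<And>i. i < length W \<Longrightarrow> W ! i = (Var_y, False) \<Longrightarrow> (inv\<^bsub>Thompson_F\<^esub> b) (pt (Suc i)) = pt i"
    using ex[of Var_y] by blast
  have Bij: "a \<in> Bij {0..1}" "b \<in> Bij {0..1}"
      "inv\<^bsub>Thompson_F\<^esub> a \<in> Bij {0..1}" "inv\<^bsub>Thompson_F\<^esub> b \<in> Bij {0..1}"
    using a b Thompson_F_simps(1) by blast+
  have pt: "pt i \<in> {0..1}" if "i \<le> length W" for i
    using grid_point_in_unit_interval[of "i + 1" K] that \<open>length W + 2 < 2 ^ K\<close>
    unfolding pt_def by linarith
  have letter: "letter_value Thompson_F a b (W ! i) (pt (Suc i)) = pt i" if "i < length W" for i
    using a_moves[OF that] b_moves[OF that]
    by (cases "(Thompson_F, a, b, W ! i)" rule: letter_value.cases) auto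
  have "\<not> satisfies_relation Thompson_F a b w" if w: "is_relation w" "length w < k" for w
  proof
    assume "satisfies_relation Thompson_F a b w"
    then have triv: "word_value Thompson_F a b w = (\<lambda>x\<in>{0..1}. x)"
      by (simp add: satisfies_relation_def Thompson_F_simps)
    obtain u s where us: "W = u @ w @ s" using W(2)[of w] w unfolding is_relation_def by blast
    \<comment> \<open>The trivial value fixes the point that \<open>w\<close> moves; since
      \<open>w\<close> is non-empty, the two indices differ, although \<open>pt\<close> is
      injective.\<close>
    have "pt (length u + length w) = pt (length u)"
      using word_value_moves_points(2)[OF Bij pt letter us] pt[of "length u + length w"] triv us
      by simp
    then show False using w(1) by (simp add: pt_def is_relation_def)
  qed
  then show ?thesis using a(1) b(1) by blast
qed

end
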